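(* Let $P$ be a set of process identifiers, $N, Y, Z \subseteq Var$, let $A = (AI, (AOp_p)_{p \in P}, AF)_{N,Y}$ and $C = (CI, (COp_p)_{p \in P}, CF)_{N,Z}$ be systems. If there exists $ref \in IntvRel_{Y,Z}$ that is a forward simulation from $A$ to $C$, then $A$ is data refined by $C$, i.e. $obs_N.C \subseteq obs_N.A$.
   Context: Fix an ordered set $\Phi \subseteq \mathbb{R}$. An interval is a contiguous subset $\Delta \subseteq \Phi$ (for all $t,t' \in \Delta$, $t'' \in \Phi$, $t \le t'' \le t'$ implies $t'' \in \Delta$); $Intv$ is the set of intervals (including $\emptyset$). $\Delta_1 \propto \Delta_2$ means $\forall t_1 \in \Delta_1, t_2 \in \Delta_2.\ t_1 < t_2$ and $\Delta_1 \cup \Delta_2 \in Intv$. For $V \subseteq Var$ (a set of variables, values in $Val$): $State_V = V \to Val$, $Stream_V = \Phi \to State_V$, $IntvPred_V = Intv \to Stream_V \to \mathbb{B}$, and $IntvRel_{Y,Z} = Intv \to Stream_Y \to Stream_Z \to \mathbb{B}$. Function application is written with a dot; operators on interval predicates are lifted pointwise (e.g. $(g_1 \wedge g_2).\Delta.s = g_1.\Delta.s \wedge g_2.\Delta.s$). For an interval predicate $g$, $(\ominus g).\Delta.s \equiv \exists \Delta_0 \in Intv.\ \Delta_0 \propto \Delta \wedge g.\Delta_0.s$. A system with observable variables $N$ and representation variables $Z$ is a tuple $C = (CI, (COp_p)_{p \in P}, CF)_{N,Z}$ with initialisation $CI : State_N \to IntvPred_Z$, processes $COp_p \in IntvPred_Z$,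 and finalisation $CF : State_Z \to State_N \to \mathbb{B}$. Its observations are $obs_N.C = \{(\rho,\rho') \in State_N \times State_N \mid \exists \Delta \in Intv, z \in Stream_Z.\ (\ominus (CI.\rho) \wedge \bigwedge_{p\in P} COp_p).\Delta.z \wedge \exists t \in \Delta.\ CF.(z.t).\rho'\}$. $A$ is data refined by $C$ iff $obs_N.C \subseteq obs_N.A$. Streams $y, y'$ match on $\Delta$ iff $\forall t \in \Delta.\ y.t = y'.t$. For $ref \in IntvRel_{Y,Z}$, $g \in IntvPred_Y$, $h \in IntvPred_Z$, $\mathsf{Sim}_{Y,Z}(ref,g,h)$ holds iff for all $z \in Stream_Z$, $\Delta,\Delta_0 \in Intv$, $y_0 \in Stream_Y$: if $\Delta_0 \propto \Delta$, $ref.\Delta_0.y_0.z$ and $h.\Delta.z$ then there is $y \in Stream_Y$ such that $y_0, y$ match on $\Delta_0$, $ref.\Delta.y.z$ and $g.\Delta.y$. $ref \in IntvRel_{Y,Z}$ is a forward simulation from $A = (AI,(AOp_p)_{p\in P},AF)_{N,Y}$ to $C = (CI,(COp_p)_{p\in P},CF)_{N,Z}$ iff (i) $\mathsf{Sim}_{Y,Z}(ref, \bigwedge_{p\in P} AOp_p, \bigwedge_{p \in P} COp_p)$; (ii) for all $z \in Stream_Z$, $\Delta \in Intv$, $\sigma \in State_N$: $CI.\sigma.\Delta.z$ implies $\exists y \in Stream_Y.\ AI.\sigma.\Delta.y \wedge ref.\Delta.y.z$; (iii) for all $z \in Stream_Z$, $y \in Stream_Y$, $\Delta \in Intv$, $\sigma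 \in State_N$ and $t \in \Delta$: $ref.\Delta.y.z \wedge CF.(z.t).\sigma$ implies $AF.(y.t).\sigma$.
   Formalization: Added hypothesis: for each state σ over N, AI.σ is local, i.e. its truth on an interval depends only on the stream's values inside that interval; without this the claim fails, as Sim only gives a stream matching y0 on the initial interval. *)

theory Defs
  imports Complex_Main "HOL-Library.FuncSet"
begin

text \<open>
  The time domain \<open>\<Phi>\<close> is a set of reals, and the sets \<open>V\<close>, \<open>N\<close>, \<open>Y\<close>, \<open>Z\<close> of variables are
  subsets of the type \<open>'var\<close>.  States and streams are partial functions, represented
  extensionally (undefined outside \<open>V\<close> and \<open>\<Phi>\<close>).  Interval predicates and relations are
  represented by total HOL functions that are only ever applied to intervals and streams
  of the appropriate kind, so their values elsewhere are irrelevant.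
\<close>

type_synonym ('var, 'val) state = "'var \<Rightarrow> 'val"
type_synonym ('var, 'val) stream = "real \<Rightarrow> ('var, 'val) state"
type_synonym ('var, 'val) intv_pred = "real set \<Rightarrow> ('var, 'val) stream \<Rightarrow> bool"
type_synonym ('var, 'val) intv_rel =
  "real set \<Rightarrow> ('var, 'val) stream \<Rightarrow> ('var, 'val) stream \<Rightarrow> bool"

definition Intv :: "real set \<Rightarrow> real set set" where
  "Intv \<Phi> = {\<Delta>. \<Delta> \<subseteq> \<Phi> \<and>
     (\<forall>t\<in>\<Delta>. \<forall>t'\<in>\<Delta>. \<forall>t''\<in>\<Phi>. t \<le> t'' \<and> t'' \<le> t' \<longrightarrow> t'' \<in> \<Delta>)}"

definition adjoins :: "real set \<Rightarrow> real set \<Rightarrow> real set \<Rightarrow> bool" where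
  "adjoins \<Phi> \<Delta>1 \<Delta>2 \<longleftrightarrow> (\<forall>t1\<in>\<Delta>1. \<forall>t2\<in>\<Delta>2. t1 < t2) \<and> \<Delta>1 \<union> \<Delta>2 \<in> Intv \<Phi>"

definition State :: "'var set \<Rightarrow> ('var, 'val) state set" where
  "State V = V \<rightarrow>\<^sub>E UNIV"

definition Stream :: "real set \<Rightarrow> 'var set \<Rightarrow> ('var, 'val) stream set" where
  "Stream \<Phi> V = \<Phi> \<rightarrow>\<^sub>E State V"

definition prev :: "real set \<Rightarrow> ('var, 'val) intv_pred \<Rightarrow> ('var, 'val) intv_pred" where
  "prev \<Phi> g = (\<lambda>\<Delta> s. \<exists>\<Delta>0\<in>Intv \<Phi>. adjoins \<Phi> \<Delta>0 \<Delta> \<and> g \<Delta>0 s)"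

record ('p, 'var, 'val) system =
  sys_init :: "('var, 'val) state \<Rightarrow> ('var, 'val) intv_pred"
  sys_op :: "'p \<Rightarrow> ('var, 'val) intv_pred"
  sys_final :: "('var, 'val) state \<Rightarrow> ('var, 'val) state \<Rightarrow> bool"

definition all_ops :: "'p set \<Rightarrow> ('p, 'var, 'val) system \<Rightarrow> ('var, 'val) intv_pred" where
  "all_ops P C = (\<lambda>\<Delta> s. \<forall>p\<in>P. sys_op C p \<Delta> s)"

definition obs ::
  "real set \<Rightarrow> 'p set \<Rightarrow> 'var set \<Rightarrow> 'var set \<Rightarrow> ('p, 'var, 'val) system
    \<Rightarrow> (('var, 'val) state \<times> ('var, 'val) state) set" where
  "obs \<Phi> P N Z C = {(\<rho>, \<rho>'). \<rho> \<in> State N \<and> \<rho>' \<in> State N \<and>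
     (\<exists>\<Delta>\<in>Intv \<Phi>. \<exists>z\<in>Stream \<Phi> Z.
        (prev \<Phi> (sys_init C \<rho>) \<Delta> z \<and> all_ops P C \<Delta> z) \<and>
        (\<exists>t\<in>\<Delta>. sys_final C (z t) \<rho>'))}"

text \<open>\<open>A\<close> has representation variables \<open>Y\<close>, and \<open>C\<close> has representation variables \<open>Z\<close>.\<close>

definition data_refined ::
  "real set \<Rightarrow> 'p set \<Rightarrow> 'var set \<Rightarrow> 'var set \<Rightarrow> 'var set
    \<Rightarrow> ('p, 'var, 'val) system \<Rightarrow> ('p, 'var, 'val) system \<Rightarrow> bool" where
  "data_refined \<Phi> P N Y Z A C \<longleftrightarrow> obs \<Phi> P N Z C \<subseteq> obs \<Phi> P N Y A"

definition match_on :: "real set \<Rightarrow> ('var, 'val) stream \<Rightarrow> ('var, 'val) stream \<Rightarrow> bool" where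
  "match_on \<Delta> y y' \<longleftrightarrow> (\<forall>t\<in>\<Delta>. y t = y' t)"

definition Sim ::
  "real set \<Rightarrow> 'var set \<Rightarrow> 'var set \<Rightarrow> ('var, 'val) intv_rel
    \<Rightarrow> ('var, 'val) intv_pred \<Rightarrow> ('var, 'val) intv_pred \<Rightarrow> bool" where
  "Sim \<Phi> Y Z ref g h \<longleftrightarrow>
     (\<forall>z\<in>Stream \<Phi> Z. \<forall>\<Delta>\<in>Intv \<Phi>. \<forall>\<Delta>0\<in>Intv \<Phi>. \<forall>y0\<in>Stream \<Phi> Y.
        adjoins \<Phi> \<Delta>0 \<Delta> \<and> ref \<Delta>0 y0 z \<and> h \<Delta> z \<longrightarrow>
        (\<exists>y\<in>Stream \<Phi> Y. match_on \<Delta>0 y0 y \<and> ref \<Delta> y z \<and> g \<Delta> y))"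

definition forward_simulation ::
  "real set \<Rightarrow> 'p set \<Rightarrow> 'var set \<Rightarrow> 'var set \<Rightarrow> 'var set \<Rightarrow> ('var, 'val) intv_rel
    \<Rightarrow> ('p, 'var, 'val) system \<Rightarrow> ('p, 'var, 'val) system \<Rightarrow> bool" where
  "forward_simulation \<Phi> P N Y Z ref A C \<longleftrightarrow>
     Sim \<Phi> Y Z ref (all_ops P A) (all_ops P C) \<and>
     (\<forall>z\<in>Stream \<Phi> Z. \<forall>\<Delta>\<in>Intv \<Phi>. \<forall>\<sigma>\<in>State N.
        sys_init C \<sigma> \<Delta> z \<longrightarrow> (\<exists>y\<in>Stream \<Phi> Y. sys_init A \<sigma> \<Delta> y \<and> ref \<Delta> y z)) \<and>
     (\<forall>z\<in>Stream \<Phi> Z. \<forall>y\<in>Stream \<Phi> Y. \<forall>\<Delta>\<in>Intv \<Phi>. \<forall>\<sigma>\<in>State N. \<forall>t\<in>\<Delta>.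
        ref \<Delta> y z \<and> sys_final C (z t) \<sigma> \<longrightarrow> sys_final A (y t) \<sigma>)"

text \<open>
  An interval predicate is local if its truth on an interval depends only on the part of
  the stream inside that interval.  Soundness of forward simulation needs this for the
  abstract initialisation: the simulating stream provided by \<open>Sim\<close> agrees with the
  initial abstract stream \<open>y0\<close> only on \<open>\<Delta>0\<close>, so a non-local initialisation that holds for
  \<open>y0\<close> on \<open>\<Delta>0\<close> may fail for the simulating stream.
\<close>

definition intv_local :: "real set \<Rightarrow> 'var set \<Rightarrow> ('var, 'val) intv_pred \<Rightarrow> bool" where
  "intv_local \<Phi> V g \<longleftrightarrow>
     (\<forall>\<Delta>\<in>Intv \<Phi>. \<forall>s\<in>Stream \<Phi> V. \<forall>s'\<in>Stream \<Phi> V.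
        match_on \<Delta> s s' \<and> g \<Delta> s \<longrightarrow> g \<Delta> s')"

end

theory Submission
  imports Defs
begin

text \<open>Any observation of \<open>C\<close> is replayed in \<open>A\<close> on the same
  intervals. The initialisation clause turns the concrete run on \<open>\<Delta>0\<close> into an
  abstract stream related to it by \<open>ref\<close>; \<open>Sim\<close> then continues that stream
  over \<open>\<Delta>\<close>, and the finalisation clause transfers the final state. The
  continuation is a new stream, so the initialisation must be carried over to it, which locality
  allows.\<close>

theorem theorem1:
  fixes \<Phi> :: "real set"
    and P :: "'p set"
    and N Y Z :: "'var set"
    and A C :: "('p, 'var, 'val) system"
  assumes init_local: "\<And>\<sigma>. \<sigma> \<in> State N \<Longrightarrow> intv_local \<Phi> Y (sys_init A \<sigma>)"
    and simulation: "\<exists>ref. forward_simulation \<Phi> P N Y Z ref A C"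
  shows "data_refined \<Phi> P N Y Z A C"
proof -
  obtain ref where fs: "forward_simulation \<Phi> P N Y Z ref A C"
    using simulation by blast
  have sim: "Sim \<Phi> Y Z ref (all_ops P A) (all_ops P C)"
    using fs by (simp add: forward_simulation_def)
  have "(\<rho>, \<rho>') \<in> obs \<Phi> P N Y A" if obs_C: "(\<rho>, \<rho>') \<in> obs \<Phi> P N Z C" for \<rho> \<rho>'
  proof -
    obtain \<Delta> \<Delta>0 z t where states: "\<rho> \<in> State N" "\<rho>' \<in> State N"
      and z: "z \<in> Stream \<Phi> Z"
      and \<Delta>: "\<Delta> \<in> Intv \<Phi>" "\<Delta>0 \<in> Intv \<Phi>" "adjoins \<Phi> \<Delta>0 \<Delta>"
      and C: "sys_init C \<rho> \<Delta>0 z" "all_ops P C \<Delta> z"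
      and t: "t \<in> \<Delta>" "sys_final C (z t) \<rho>'"
      using obs_C unfolding obs_def prev_def by auto
    obtain y0 where y0: "y0 \<in> Stream \<Phi> Y" "sys_init A \<rho> \<Delta>0 y0" "ref \<Delta>0 y0 z"
      using fs z \<Delta>(2) states(1) C(1) unfolding forward_simulation_def by blast
    obtain y where y: "y \<in> Stream \<Phi> Y" "match_on \<Delta>0 y0 y" "ref \<Delta> y z" "all_ops P A \<Delta> y"
      using sim z \<Delta> y0(1,3) C(2) unfolding Sim_def by blast
    \<comment> \<open>\<open>y\<close> may differ from \<open>y0\<close> outside
      \<open>\<Delta>0\<close>, but the initialisation only looks inside \<open>\<Delta>0\<close>,
      where the two match.\<close>
    have "sys_init A \<rho> \<Delta>0 y"
      using init_local[OF states(1)] \<Delta>(2) y0(1,2) y(1,2) unfolding intv_local_def by blast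
    moreover have "sys_final A (y t) \<rho>'"
      using fs z y(1,3) \<Delta>(1) states(2) t unfolding forward_simulation_def by blast
    \<comment> \<open>The abstract observation is witnessed by the concrete \<open>\<Delta>\<close>,
      \<open>\<Delta>0\<close> and \<open>t\<close>, with \<open>y\<close> in place of
      \<open>z\<close>.\<close>
    ultimately show ?thesis
      using states \<Delta> y(1,4) t(1) unfolding obs_def prev_def by auto
  qed
  then show ?thesis
    unfolding data_refined_def by auto
qed

end
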